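(* Let $n\ge 0$ and $L>0$ be integers. For $z\in\mathcal{T}_L$ let $f_n(z)$ be the number of forward paths in $\mathcal{T}_L$ of length $n$ starting at $z$, and for $\ell\ge 0$ let $m_n(\ell)$ be the number of Motzkin meanders of length $n$ starting at height $\ell$ with amplitude bounded by $L$. Then, for every $\ell\in\{0,\dots,\lfloor L/2\rfloor\}$, $$f_n(\mathcal{O}+\ell s_1)=\sum_{i=0}^{\ell} m_n(i).$$
   Context: $\mathbb{N}=\{0,1,2,\dots\}$ and $(e_1,e_2,e_3)$ is the standard basis of $\mathbb{R}^3$. $\mathcal{T}_L=\{x_1e_1+x_2e_2+x_3e_3 : x_1,x_2,x_3\in\mathbb{N},\ x_1+x_2+x_3=L\}$, with origin $\mathcal{O}=Le_3$. Forward steps: $s_1=e_1-e_3$, $s_2=e_2-e_1$, $s_3=e_3-e_2$. A forward path of length $n$ starting from $z\in\mathcal{T}_L$ is a sequence $(\sigma_1,\dots,\sigma_n)\in\{s_1,s_2,s_3\}^n$ such that $z+\sum_{i=1}^k\sigma_i\in\mathcal{T}_L$ for all $k\in\{0,\dots,n\}$. A Motzkin path is a sequence of steps $\nearrow$ (height $+1$), $\rightarrow$ (height unchanged), $\searrow$ (height $-1$) which starts at height $0$, stays at height $\ge 0$ and ends at height $0$. A Motzkin meander is a suffix of a Motzkin path, i.e. it starts at some height $\ge 0$, stays at height $\ge 0$ and ends at height $0$. The amplitude of a Motzkin path or meander with maximum height $h$ (the starting height included) is $2h+1$ if a horizontal step $\rightarrow$ is performed at height $h$, and $2h$ otherwise.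 "Amplitude bounded by $L$" means amplitude $\le L$. *)

theory Defs
  imports "HOL-Analysis.Analysis" "HOL-Library.Sublist"
begin

(* The index type 3 is {0, 1, 2} modulo 3, so the index written 3 is 0; the indices 1, 2, 3
   are pairwise distinct and exhaust the type. *)
definition e\<^sub>1 :: "real ^ 3" where "e\<^sub>1 = axis 1 1"
definition e\<^sub>2 :: "real ^ 3" where "e\<^sub>2 = axis 2 1"
definition e\<^sub>3 :: "real ^ 3" where "e\<^sub>3 = axis 3 1"

definition triangle :: "nat \<Rightarrow> (real ^ 3) set" where
  "triangle L =
     {real x\<^sub>1 *\<^sub>R e\<^sub>1 + real x\<^sub>2 *\<^sub>R e\<^sub>2 + real x\<^sub>3 *\<^sub>R e\<^sub>3 | x\<^sub>1 x\<^sub>2 x\<^sub>3. x\<^sub>1 + x\<^sub>2 + x\<^sub>3 = L}"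

definition origin :: "nat \<Rightarrow> real ^ 3" where
  "origin L = real L *\<^sub>R e\<^sub>3"

definition s\<^sub>1 :: "real ^ 3" where "s\<^sub>1 = e\<^sub>1 - e\<^sub>3"
definition s\<^sub>2 :: "real ^ 3" where "s\<^sub>2 = e\<^sub>2 - e\<^sub>1"
definition s\<^sub>3 :: "real ^ 3" where "s\<^sub>3 = e\<^sub>3 - e\<^sub>2"

definition forward_path :: "nat \<Rightarrow> real ^ 3 \<Rightarrow> (real ^ 3) list \<Rightarrow> bool" where
  "forward_path L z \<sigma> \<longleftrightarrow>
     set \<sigma> \<subseteq> {s\<^sub>1, s\<^sub>2, s\<^sub>3} \<and> (\<forall>k\<le>length \<sigma>. z + sum_list (take k \<sigma>) \<in> triangle L)"

definition num_forward_paths :: "nat \<Rightarrow> nat \<Rightarrow> real ^ 3 \<Rightarrow> nat" where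
  "num_forward_paths L n z = card {\<sigma>. length \<sigma> = n \<and> forward_path L z \<sigma>}"

datatype motzkin_step = Up | Horizontal | Down

fun rise :: "motzkin_step \<Rightarrow> int" where
  "rise Up = 1"
| "rise Horizontal = 0"
| "rise Down = - 1"

definition height :: "nat \<Rightarrow> motzkin_step list \<Rightarrow> nat \<Rightarrow> int" where
  "height l w k = int l + sum_list (map rise (take k w))"

definition motzkin_path :: "motzkin_step list \<Rightarrow> bool" where
  "motzkin_path w \<longleftrightarrow> (\<forall>k\<le>length w. 0 \<le> height 0 w k) \<and> height 0 w (length w) = 0"

(* The starting height l is an argument; it is determined by w, because the final height is 0.
   The description as suffixes of Motzkin paths is motzkin_meander_iff_suffix below. *)
definition motzkin_meander :: "nat \<Rightarrow> motzkin_step list \<Rightarrow> bool" where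
  "motzkin_meander l w \<longleftrightarrow> (\<forall>k\<le>length w. 0 \<le> height l w k) \<and> height l w (length w) = 0"

definition max_height :: "nat \<Rightarrow> motzkin_step list \<Rightarrow> int" where
  "max_height l w = Max (height l w ` {0..length w})"

definition amplitude :: "nat \<Rightarrow> motzkin_step list \<Rightarrow> int" where
  "amplitude l w =
     (if \<exists>k<length w. w ! k = Horizontal \<and> height l w k = max_height l w
      then 2 * max_height l w + 1 else 2 * max_height l w)"

definition num_motzkin_meanders :: "nat \<Rightarrow> nat \<Rightarrow> nat \<Rightarrow> nat" where
  "num_motzkin_meanders L n l =
     card {w. length w = n \<and> motzkin_meander l w \<and> amplitude l w \<le> int L}"

lemma motzkin_path_iff_meander: "motzkin_path w \<longleftrightarrow> motzkin_meander 0 w"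
  by (simp add: motzkin_path_def motzkin_meander_def)

lemma height_append_left: "k \<le> length u \<Longrightarrow> height l (u @ w) k = height l u k"
  by (simp add: height_def)

lemma height_append_right:
  "height 0 u (length u) = int l \<Longrightarrow> height 0 (u @ w) (length u + k) = height l w k"
  by (simp add: height_def)

lemma motzkin_meander_iff:
  "motzkin_meander l w \<longleftrightarrow> (\<exists>u. motzkin_path (u @ w) \<and> height 0 u (length u) = int l)"
proof
  assume w: "motzkin_meander l w"
  define u where "u = replicate l Up"
  have u: "height 0 u k = int k" if "k \<le> l" for k
    using that by (simp add: u_def height_def sum_list_replicate min_def)
  have l: "height 0 u (length u) = int l" "length u = l"
    using u[of l] by (simp_all add: u_def)
  have "0 \<le> height 0 (u @ w) k" if "k \<le> length (u @ w)" for k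
  proof (cases "k \<le> l")
    case True
    then show ?thesis using u l by (simp add: height_append_left)
  next
    case False
    then have "height 0 (u @ w) k = height l w (k - l)"
      using height_append_right[OF l(1), of w "k - l"] l(2) by simp
    then show ?thesis using w that l(2) by (simp add: motzkin_meander_def)
  qed
  moreover have "height 0 (u @ w) (length (u @ w)) = 0"
    using w height_append_right[OF l(1), of w "length w"] by (simp add: motzkin_meander_def)
  ultimately show "\<exists>u. motzkin_path (u @ w) \<and> height 0 u (length u) = int l"
    using l(1) unfolding motzkin_path_def by blast
next
  assume "\<exists>u. motzkin_path (u @ w) \<and> height 0 u (length u) = int l"
  then obtain u where p: "motzkin_path (u @ w)" and l: "height 0 u (length u) = int l"
    by blast
  have "0 \<le> height l w k" if "k \<le> length w" for k
  proof -
    have "length u + k \<le> length (u @ w)"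
      using that by simp
    then have "0 \<le> height 0 (u @ w) (length u + k)"
      using p unfolding motzkin_path_def by blast
    then show ?thesis
      by (simp add: height_append_right[OF l])
  qed
  moreover have "height l w (length w) = 0"
    using p height_append_right[OF l, of w "length w"] by (simp add: motzkin_path_def)
  ultimately show "motzkin_meander l w"
    by (simp add: motzkin_meander_def)
qed

lemma motzkin_meander_iff_suffix:
  "(\<exists>l. motzkin_meander l w) \<longleftrightarrow> (\<exists>p. motzkin_path p \<and> suffix w p)"
proof
  assume "\<exists>l. motzkin_meander l w"
  then show "\<exists>p. motzkin_path p \<and> suffix w p"
    by (auto simp: motzkin_meander_iff suffix_def)
next
  assume "\<exists>p. motzkin_path p \<and> suffix w p"
  then obtain u where p: "motzkin_path (u @ w)"
    by (auto simp: suffix_def)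
  then have "0 \<le> height 0 (u @ w) (length u)"
    unfolding motzkin_path_def by simp
  then have "height 0 u (length u) = int (nat (height 0 u (length u)))"
    by (simp add: height_append_left)
  then show "\<exists>l. motzkin_meander l w"
    using p unfolding motzkin_meander_iff by blast
qed

end

(* Write (x1, x2) for the point x1 e1 + x2 e2 + (L - x1 - x2) e3. The idea is to count the forward
   paths from every point, not only from those of the edge: if m is extended to {0..L+1} by the
   antisymmetry m(L + 1 - i) = - m(i), then the number of forward paths from (x1, x2) is the sum of
   m(i + j) over 0 <= i <= x1 and 0 <= j <= x2. Antisymmetry makes m(i - 1) + m(i) + m(i + 1) the
   value for n + 1 throughout {0..L} (with m(-1) = 0), in agreement with the bound on the
   amplitude, and the double sum turns this recursion into the one for forward paths. The sum is
   empty outside the sides x1 = 0 and x2 = 0, and vanishes by antisymmetry outside the third side,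
   x1 + x2 = L + 1. For x2 = 0 and x1 <= L / 2 the extension plays no role. *)

theory Submission
  imports Defs
begin

text \<open>Prepending a letter is injective, and words with different first letters differ. Both
  counts get their recursion in the length from this.\<close>

lemma card_lists_Suc:
  assumes "finite S" and "\<And>x xs. P (x # xs) \<Longrightarrow> x \<in> S"
    and "\<And>x. finite {xs. length xs = n \<and> P (x # xs)}"
  shows "card {xs. length xs = Suc n \<and> P xs} = (\<Sum>x\<in>S. card {xs. length xs = n \<and> P (x # xs)})"
proof -
  have "{xs. length xs = Suc n \<and> P xs} =
      (\<Union>x\<in>S. (#) x ` {xs. length xs = n \<and> P (x # xs)})"
    using assms(2) by (auto simp: length_Suc_conv)
  then have "card {xs. length xs = Suc n \<and> P xs} =
      (\<Sum>x\<in>S. card ((#) x ` {xs. length xs = n \<and> P (x # xs)}))"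
    using assms(1,3) by (auto intro!: card_UN_disjoint)
  then show ?thesis
    by (simp add: card_image)
qed

section \<open>Forward paths\<close>

text \<open>Integer coordinates, so that a step out of the triangle still ends at a
  \<open>point\<close>.\<close>

definition point :: "nat \<Rightarrow> int \<Rightarrow> int \<Rightarrow> real ^ 3" where
  "point L a b = of_int a *\<^sub>R e\<^sub>1 + of_int b *\<^sub>R e\<^sub>2 + of_int (int L - a - b) *\<^sub>R e\<^sub>3"

lemma e_nth [simp]:
  "e\<^sub>1 $ 1 = 1" "e\<^sub>1 $ 2 = 0" "e\<^sub>1 $ 3 = 0"
  "e\<^sub>2 $ 1 = 0" "e\<^sub>2 $ 2 = 1" "e\<^sub>2 $ 3 = 0"
  "e\<^sub>3 $ 1 = 0" "e\<^sub>3 $ 2 = 0" "e\<^sub>3 $ 3 = 1"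
  by (simp_all add: e\<^sub>1_def e\<^sub>2_def e\<^sub>3_def axis_def)

lemma point_nth [simp]:
  "point L a b $ 1 = of_int a" "point L a b $ 2 = of_int b" "point L a b $ 3 = of_int (int L - a - b)"
  by (simp_all add: point_def)

lemma point_add_step:
  "point L a b + s\<^sub>1 = point L (a + 1) b"
  "point L a b + s\<^sub>2 = point L (a - 1) (b + 1)"
  "point L a b + s\<^sub>3 = point L a (b - 1)"
  by (simp_all add: vec_eq_iff forall_3 s\<^sub>1_def s\<^sub>2_def s\<^sub>3_def)

lemma point_in_triangle_iff: "point L a b \<in> triangle L \<longleftrightarrow> 0 \<le> a \<and> 0 \<le> b \<and> a + b \<le> int L"
proof
  assume "point L a b \<in> triangle L"
  then obtain x y z :: nat
    where p: "point L a b = real x *\<^sub>R e\<^sub>1 + real y *\<^sub>R e\<^sub>2 + real z *\<^sub>R e\<^sub>3" and "x + y + z = L"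
    unfolding triangle_def by blast
  moreover have "real_of_int a = real x" "real_of_int b = real y"
    using arg_cong[OF p, of "\<lambda>v. v $ 1"] arg_cong[OF p, of "\<lambda>v. v $ 2"] by simp_all
  then have "a = int x" "b = int y"
    by linarith+
  ultimately show "0 \<le> a \<and> 0 \<le> b \<and> a + b \<le> int L"
    by simp
next
  assume ab: "0 \<le> a \<and> 0 \<le> b \<and> a + b \<le> int L"
  then have "point L a b =
      real (nat a) *\<^sub>R e\<^sub>1 + real (nat b) *\<^sub>R e\<^sub>2 + real (nat (int L - a - b)) *\<^sub>R e\<^sub>3"
    by (simp add: point_def)
  moreover have "nat a + nat b + nat (int L - a - b) = L"
    using ab by linarith
  ultimately show "point L a b \<in> triangle L"
    unfolding triangle_def by blast
qed

lemma steps_distinct: "s\<^sub>1 \<noteq> s\<^sub>2" "s\<^sub>1 \<noteq> s\<^sub>3" "s\<^sub>2 \<noteq> s\<^sub>3"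
  by (auto simp: vec_eq_iff forall_3 s\<^sub>1_def s\<^sub>2_def s\<^sub>3_def)

lemma forward_path_Nil: "forward_path L z [] \<longleftrightarrow> z \<in> triangle L"
  by (simp add: forward_path_def)

lemma all_le_Suc_iff: "(\<forall>k\<le>Suc n. P k) \<longleftrightarrow> P 0 \<and> (\<forall>k\<le>n. P (Suc k))"
  using All_less_Suc2[of "Suc n" P] by (simp add: less_Suc_eq_le)

lemma forward_path_Cons:
  "forward_path L z (s # \<sigma>) \<longleftrightarrow> z \<in> triangle L \<and> s \<in> {s\<^sub>1, s\<^sub>2, s\<^sub>3} \<and> forward_path L (z + s) \<sigma>"
  by (auto simp: forward_path_def all_le_Suc_iff add.assoc)

lemma finite_forward_paths: "finite {\<sigma>. length \<sigma> = n \<and> forward_path L z \<sigma>}"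
  by (rule finite_subset[OF _ finite_lists_length_eq[of "{s\<^sub>1, s\<^sub>2, s\<^sub>3}" n]])
    (auto simp: forward_path_def)

text \<open>The empty prefix already violates the condition. Hence the recursion below can sum over
  all three steps, even at the boundary.\<close>

lemma num_forward_paths_outside: "z \<notin> triangle L \<Longrightarrow> num_forward_paths L n z = 0"
proof -
  assume "z \<notin> triangle L"
  then have "\<not> forward_path L z \<sigma>" for \<sigma>
    unfolding forward_path_def by (auto intro!: exI[of _ 0])
  then show ?thesis
    by (simp add: num_forward_paths_def)
qed

lemma num_forward_paths_0: "z \<in> triangle L \<Longrightarrow> num_forward_paths L 0 z = 1"
proof -
  assume "z \<in> triangle L"
  then have "{\<sigma>. length \<sigma> = 0 \<and> forward_path L z \<sigma>} = {[]}"
    by (auto simp: forward_path_Nil)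
  then show ?thesis
    by (simp add: num_forward_paths_def)
qed

lemma num_forward_paths_Suc:
  assumes "z \<in> triangle L"
  shows "num_forward_paths L (Suc n) z =
    num_forward_paths L n (z + s\<^sub>1) + num_forward_paths L n (z + s\<^sub>2) + num_forward_paths L n (z + s\<^sub>3)"
proof -
  have "finite {\<sigma>. length \<sigma> = n \<and> forward_path L z (s # \<sigma>)}" for s
    by (rule finite_subset[OF _ finite_forward_paths[of n L "z + s"]]) (auto simp: forward_path_Cons)
  then have "num_forward_paths L (Suc n) z =
      (\<Sum>s\<in>{s\<^sub>1, s\<^sub>2, s\<^sub>3}. card {\<sigma>. length \<sigma> = n \<and> forward_path L z (s # \<sigma>)})"
    unfolding num_forward_paths_def by (intro card_lists_Suc) (auto simp: forward_path_Cons)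
  also have "\<dots> = (\<Sum>s\<in>{s\<^sub>1, s\<^sub>2, s\<^sub>3}. num_forward_paths L n (z + s))"
    unfolding num_forward_paths_def using assms by (intro sum.cong) (auto simp: forward_path_Cons)
  finally show ?thesis
    using steps_distinct by simp
qed

section \<open>Motzkin meanders\<close>

definition bounded_meander :: "nat \<Rightarrow> nat \<Rightarrow> motzkin_step list \<Rightarrow> bool" where
  "bounded_meander L l w \<longleftrightarrow> motzkin_meander l w \<and> amplitude l w \<le> int L"

text \<open>Replaces the maximum by conditions on single positions, which survive the removal of the
  first letter. A horizontal step at a height \<open>h\<close> below the maximum \<open>M\<close> is
  harmless, as \<open>2 * h + 1 < 2 * M\<close> for integers.\<close>

lemma amplitude_le_iff:
  "amplitude l w \<le> int L \<longleftrightarrow> (\<forall>k\<le>length w. 2 * height l w k \<le> int L) \<and>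
     (\<forall>k<length w. w ! k = Horizontal \<longrightarrow> 2 * height l w k + 1 \<le> int L)"
  (is "?A \<longleftrightarrow> ?B")
proof -
  let ?H = "height l w ` {0..length w}"
  have le: "height l w k \<le> max_height l w" if "k \<le> length w" for k
    unfolding max_height_def using that by (intro Max_ge) auto
  have "max_height l w \<in> ?H"
    unfolding max_height_def by (intro Max_in) auto
  then obtain m where m: "m \<le> length w" "max_height l w = height l w m"
    by auto
  show ?thesis
  proof
    assume A: ?A
    then have max: "2 * max_height l w \<le> int L"
      by (simp add: amplitude_def split: if_splits)
    have "2 * height l w k + 1 \<le> int L" if k: "k < length w" "w ! k = Horizontal" for k
    proof (cases "height l w k = max_height l w")
      case True
      then have "amplitude l w = 2 * max_height l w + 1"
        using k by (auto simp: amplitude_def)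
      then show ?thesis
        using A True by simp
    next
      case False
      then show ?thesis
        using le[of k] k max by linarith
    qed
    moreover have "2 * height l w k \<le> int L" if "k \<le> length w" for k
      using le[OF that] max by linarith
    ultimately show ?B
      by blast
  next
    assume ?B
    then show ?A
      using m by (auto simp: amplitude_def)
  qed
qed

lemma height_0 [simp]: "height l w 0 = int l"
  by (simp add: height_def)

lemma height_Cons_Suc:
  "int l' = int l + rise s \<Longrightarrow> height l (s # w) (Suc k) = height l' w k"
  by (simp add: height_def)

lemma bounded_meander_iff:
  "bounded_meander L l w \<longleftrightarrow>
     (\<forall>k\<le>length w. 0 \<le> height l w k \<and> 2 * height l w k \<le> int L) \<and> height l w (length w) = 0 \<and>
     (\<forall>k<length w. w ! k = Horizontal \<longrightarrow> 2 * height l w k + 1 \<le> int L)"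
  by (auto simp: bounded_meander_def motzkin_meander_def amplitude_le_iff)

lemma bounded_meander_Nil: "bounded_meander L l [] \<longleftrightarrow> l = 0"
  by (auto simp: bounded_meander_iff)

lemma bounded_meander_Cons:
  assumes "int l' = int l + rise s"
  shows "bounded_meander L l (s # w) \<longleftrightarrow>
    2 * l \<le> L \<and> (s = Horizontal \<longrightarrow> 2 * l + 1 \<le> L) \<and> bounded_meander L l' w"
  by (auto simp: bounded_meander_iff all_le_Suc_iff All_less_Suc2 height_Cons_Suc[OF assms])

text \<open>The rule for a first letter wants a natural number as the new height, so the step below
  0 is treated apart.\<close>

lemma not_bounded_meander_0_Down: "\<not> bounded_meander L 0 (Down # w)"
  by (auto simp: bounded_meander_iff all_le_Suc_iff height_def)

lemma UNIV_motzkin_step: "UNIV = {Up, Horizontal, Down}"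
  using motzkin_step.exhaust by blast

lemma finite_UNIV_motzkin_step [simp]: "finite (UNIV :: motzkin_step set)"
  unfolding UNIV_motzkin_step by simp

lemma finite_motzkin_words: "finite {w :: motzkin_step list. length w = n \<and> P w}"
  by (rule finite_subset[OF _ finite_lists_length_eq[of "UNIV :: motzkin_step set" n]]) auto

lemma num_motzkin_meanders_eq:
  "num_motzkin_meanders L n l = card {w. length w = n \<and> bounded_meander L l w}"
  by (simp add: num_motzkin_meanders_def bounded_meander_def)

lemma num_motzkin_meanders_0: "num_motzkin_meanders L 0 l = (if l = 0 then 1 else 0)"
proof -
  have "{w. length w = 0 \<and> bounded_meander L l w} = (if l = 0 then {[]} else {})"
    by (auto simp: bounded_meander_Nil)
  then show ?thesis
    by (simp add: num_motzkin_meanders_eq)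
qed

text \<open>The starting height counts towards the maximum.\<close>

lemma num_motzkin_meanders_high: "L < 2 * l \<Longrightarrow> num_motzkin_meanders L n l = 0"
proof -
  assume "L < 2 * l"
  then have "\<not> bounded_meander L l w" for w
    unfolding bounded_meander_iff by (auto intro!: exI[of _ 0])
  then show ?thesis
    by (simp add: num_motzkin_meanders_eq)
qed

text \<open>A horizontal step is forbidden only if \<open>2 * l = L\<close>. The term for
  \<open>Up\<close> carries no condition, since it vanishes by itself when \<open>Suc l\<close> is
  too high.\<close>

lemma num_motzkin_meanders_Suc:
  assumes "2 * l \<le> L"
  shows "num_motzkin_meanders L (Suc n) l =
    num_motzkin_meanders L n (Suc l)
    + (if 2 * l + 1 \<le> L then num_motzkin_meanders L n l else 0)
    + (if l = 0 then 0 else num_motzkin_meanders L n (l - 1))"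
proof -
  have "num_motzkin_meanders L (Suc n) l =
      (\<Sum>s\<in>{Up, Horizontal, Down}. card {w. length w = n \<and> bounded_meander L l (s # w)})"
    unfolding num_motzkin_meanders_eq
    by (intro card_lists_Suc finite_motzkin_words) (simp_all flip: UNIV_motzkin_step)
  moreover have "bounded_meander L l (Up # w) \<longleftrightarrow> bounded_meander L (Suc l) w"
    and "bounded_meander L l (Horizontal # w) \<longleftrightarrow> 2 * l + 1 \<le> L \<and> bounded_meander L l w"
    and "bounded_meander L l (Down # w) \<longleftrightarrow> l \<noteq> 0 \<and> bounded_meander L (l - 1) w" for w
    using assms bounded_meander_Cons[of "Suc l" l Up] bounded_meander_Cons[of l l Horizontal]
      bounded_meander_Cons[of "l - 1" l Down] not_bounded_meander_0_Down[of L w]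
    by (cases "l = 0"; simp)+
  ultimately show ?thesis
    by (simp add: num_motzkin_meanders_eq)
qed

section \<open>The antisymmetric extension and its double sums\<close>

(* At most one of the two terms is nonzero, since there are no meanders from heights above L / 2.
   Only the arguments i <= L + 1 matter. *)
definition extended_meanders :: "nat \<Rightarrow> nat \<Rightarrow> nat \<Rightarrow> int" where
  "extended_meanders L n i =
     int (num_motzkin_meanders L n i) - int (num_motzkin_meanders L n (L + 1 - i))"

lemma extended_meanders_antisym:
  "i \<le> L + 1 \<Longrightarrow> extended_meanders L n (L + 1 - i) = - extended_meanders L n i"
  by (simp add: extended_meanders_def)

lemma extended_meanders_low:
  "2 * i \<le> L \<Longrightarrow> extended_meanders L n i = int (num_motzkin_meanders L n i)"
  by (simp add: extended_meanders_def num_motzkin_meanders_high)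

text \<open>The bound keeps out \<open>i = L + 1\<close>, where the value is -1.\<close>

lemma extended_meanders_0:
  "i \<le> L \<Longrightarrow> extended_meanders L 0 i = (if i = 0 then 1 else 0)"
  by (simp add: extended_meanders_def num_motzkin_meanders_0)

lemma extended_meanders_Suc_low:
  assumes "L > 0" and "2 * i \<le> L"
  shows "extended_meanders L (Suc n) i =
    extended_meanders L n i + extended_meanders L n (i + 1)
    + (if i = 0 then 0 else extended_meanders L n (i - 1))"
proof (cases "2 * i = L")
  case True
  \<comment> \<open>Here \<open>i + 1\<close> is the mirror image of \<open>i\<close>, so the first
    two terms cancel. This matches the meanders: at height L/2 both \<open>Horizontal\<close> and
    \<open>Up\<close> exceed the amplitude.\<close>
  then have "extended_meanders L n (i + 1) = - extended_meanders L n i"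
    using extended_meanders_antisym[of i L n] by (simp add: Suc_diff_le flip: True)
  then show ?thesis
    using True assms
    by (simp add: extended_meanders_low num_motzkin_meanders_Suc num_motzkin_meanders_high)
next
  case False
  \<comment> \<open>The mirror image \<open>L - i\<close> of \<open>i + 1\<close> lies above
    L/2.\<close>
  have "num_motzkin_meanders L n (L - i) = 0"
    using False assms by (intro num_motzkin_meanders_high) linarith
  then have "extended_meanders L n (i + 1) = int (num_motzkin_meanders L n (i + 1))"
    by (simp add: extended_meanders_def)
  then show ?thesis
    using False assms by (simp add: extended_meanders_low num_motzkin_meanders_Suc)
qed

text \<open>The recursion is invariant under \<open>i\<close> -> \<open>L + 1 - i\<close>, which
  carries the lower half to the upper half.\<close>

lemma extended_meanders_Suc:
  assumes "L > 0" and "i \<le> L"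
  shows "extended_meanders L (Suc n) i =
    extended_meanders L n i + extended_meanders L n (i + 1)
    + (if i = 0 then 0 else extended_meanders L n (i - 1))"
proof (cases "2 * i \<le> L")
  case True
  then show ?thesis
    using assms extended_meanders_Suc_low by blast
next
  case False
  define j where "j = L + 1 - i"
  have i: "i = L + 1 - j" "i + 1 = L + 1 - (j - 1)" "i - 1 = L + 1 - (j + 1)"
    and j: "0 < j" "j < L + 1" "2 * j \<le> L + 1"
    using False assms(2) by (auto simp: j_def)
  have anti: "extended_meanders L n i = - extended_meanders L n j"
    "extended_meanders L n (i + 1) = - extended_meanders L n (j - 1)"
    "extended_meanders L n (i - 1) = - extended_meanders L n (j + 1)" for n
    using extended_meanders_antisym[of j L n] extended_meanders_antisym[of "j - 1" L n]
      extended_meanders_antisym[of "j + 1" L n] j unfolding i(2,3) unfolding i(1) by simp_all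
  show ?thesis
  proof (cases "2 * j \<le> L")
    case True
    then show ?thesis
      using extended_meanders_Suc_low[OF assms(1) True, of n] False j unfolding anti by simp
  next
    case False
    \<comment> \<open>At the fixed point of the reflection the value is its own negative, hence 0,
      and the two neighbours cancel.\<close>
    then have "i = j"
      using i j by simp
    then show ?thesis
      using anti(1)[of n] anti(1)[of "Suc n"] anti(2)[of n] j by simp
  qed
qed

text \<open>\<open>a\<close> and \<open>b\<close> are numbers of terms, one more than the
  coordinates of the point; a coordinate -1 thus gives an empty sum.\<close>

definition double_sum :: "(nat \<Rightarrow> int) \<Rightarrow> nat \<Rightarrow> nat \<Rightarrow> int" where
  "double_sum m a b = (\<Sum>j<b. \<Sum>i<a. m (i + j))"

lemma double_sum_0 [simp]: "double_sum m 0 b = 0" "double_sum m a 0 = 0"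
  by (simp_all add: double_sum_def)

lemma double_sum_Suc: "double_sum m a (Suc b) = double_sum m a b + (\<Sum>i<a. m (i + b))"
  by (simp add: double_sum_def)

text \<open>Turning the rectangle by 180 degrees replaces \<open>i + j\<close> by
  \<open>N - (i + j)\<close>, so the sum equals its own negative.\<close>

lemma double_sum_antisym:
  assumes "\<And>i. i \<le> N \<Longrightarrow> m (N - i) = - m i" and "a + b = N"
  shows "double_sum m (Suc a) (Suc b) = 0"
proof -
  have "double_sum m (Suc a) (Suc b) = (\<Sum>j<Suc b. \<Sum>i<Suc a. m ((a - i) + (b - j)))"
    unfolding double_sum_def
    using sum.nat_diff_reindex[of "\<lambda>i. m (i + _)" "Suc a"]
      sum.nat_diff_reindex[of "\<lambda>j. \<Sum>i<Suc a. m (a - i + j)" "Suc b"]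
    by (simp del: sum.lessThan_Suc)
  also have "\<dots> = (\<Sum>j<Suc b. \<Sum>i<Suc a. - m (i + j))"
  proof (intro sum.cong refl)
    fix i j assume "j \<in> {..<Suc b}" and "i \<in> {..<Suc a}"
    then have "(a - i) + (b - j) = N - (i + j)" and "i + j \<le> N"
      using assms(2) by auto
    then show "m ((a - i) + (b - j)) = - m (i + j)"
      using assms(1) by simp
  qed
  also have "\<dots> = - double_sum m (Suc a) (Suc b)"
    by (simp only: double_sum_def sum_negf)
  finally show ?thesis
    by simp
qed

text \<open>The three rectangles on the right belong to the points reached by
  \<open>s\<^sub>1\<close>, \<open>s\<^sub>2\<close> and \<open>s\<^sub>3\<close>. In the induction
  on \<open>b\<close>, the row gained on the left equals the sum of the rows gained by these
  rectangles.\<close>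

lemma double_sum_recursion:
  assumes "\<And>i. i \<le> a + b \<Longrightarrow> m' i = m i + m (i + 1) + (if i = 0 then 0 else m (i - 1))"
  shows "double_sum m' (Suc a) (Suc b) =
    double_sum m (Suc (Suc a)) (Suc b) + double_sum m a (Suc (Suc b)) + double_sum m (Suc a) b"
  using assms
proof (induction b)
  case 0
  then have "(\<Sum>i<Suc a. m' i) =
      (\<Sum>i<Suc a. m i + m (i + 1) + (if i = 0 then 0 else m (i - 1)))"
    by (intro sum.cong) auto
  \<comment> \<open>The terms \<open>m (i - 1)\<close> form the first row of the second rectangle;
    the third is still empty.\<close>
  also have "\<dots> = (\<Sum>i<Suc (Suc a). m i) + ((\<Sum>i<a. m i) + (\<Sum>i<a. m (i + 1)))"
    by (induction a) auto
  finally show ?case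
    by (simp add: double_sum_Suc)
next
  case (Suc b)
  have shift: "(\<Sum>i<Suc k. m (i + c)) = m c + (\<Sum>i<k. m (i + Suc c))" for k c
    by (subst sum.lessThan_Suc_shift) simp
  have "(\<Sum>i<Suc a. m' (i + Suc b)) =
      (\<Sum>i<Suc a. m (i + Suc b) + m (i + Suc (Suc b)) + m (i + b))"
    using Suc.prems by (intro sum.cong) auto
  \<comment> \<open>The index ranges b+1..a+b+1 and b+2..a+b+2 are regrouped as b+1..a+b+2 and
    b+2..a+b+1.\<close>
  also have "\<dots> = (\<Sum>i<Suc (Suc a). m (i + Suc b)) + (\<Sum>i<a. m (i + Suc (Suc b))) + (\<Sum>i<Suc a. m (i + b))"
    unfolding sum.distrib using shift[of "Suc b" "Suc a"] shift[of "Suc b" a] by linarith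
  finally show ?case
    using Suc.IH Suc.prems
    by (simp only: double_sum_Suc[of _ _ "Suc b"] double_sum_Suc[of _ _ "Suc (Suc b)"]
        double_sum_Suc[of "m" "Suc a" b])
qed

text \<open>All indices \<open>i + j\<close> are at most \<open>L\<close>, so only the corner
  \<open>i = j = 0\<close> contributes.\<close>

lemma double_sum_initial:
  assumes "a + b \<le> L"
  shows "double_sum (extended_meanders L 0) (Suc a) (Suc b) = 1"
proof -
  have "double_sum (extended_meanders L 0) (Suc a) (Suc b) =
      (\<Sum>j<Suc b. if j = 0 then \<Sum>i<Suc a. if i = 0 then 1 else 0 else 0)"
    unfolding double_sum_def using assms
    by (intro sum.cong refl) (auto simp: extended_meanders_0 intro!: sum.cong sum.neutral
        simp del: sum.lessThan_Suc)
  also have "\<dots> = 1"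
    by (simp del: sum.lessThan_Suc)
  finally show ?thesis .
qed

(* Shifting both coordinates by one also covers the points at distance one outside the
   triangle, where both sides vanish. *)
lemma interior_or_zero:
  assumes "a + b \<le> L + 3"
  shows "(\<exists>x y. a = Suc x \<and> b = Suc y \<and> x + y \<le> L) \<or>
    num_forward_paths L n (point L (int a - 1) (int b - 1)) = 0 \<and>
    double_sum (extended_meanders L n) a b = 0"
proof (cases "a = 0 \<or> b = 0 \<or> a + b = L + 3")
  case True
  then have "num_forward_paths L n (point L (int a - 1) (int b - 1)) = 0"
    by (intro num_forward_paths_outside) (auto simp: point_in_triangle_iff)
  moreover have "double_sum (extended_meanders L n) a b = 0"
  proof (cases "a = 0 \<or> b = 0")
    case False
    then obtain x y where "a = Suc x" "b = Suc y"
      by (meson not0_implies_Suc)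
    \<comment> \<open>Now \<open>x + y = L + 1\<close>: the point lies just beyond the third side,
      where the rectangle is antisymmetric.\<close>
    then show ?thesis
      using True False by (auto intro!: double_sum_antisym[of "L + 1"] extended_meanders_antisym)
  qed auto
  ultimately show ?thesis
    by simp
next
  case False
  then have "a = Suc (a - 1) \<and> b = Suc (b - 1) \<and> (a - 1) + (b - 1) \<le> L"
    using assms by auto
  then show ?thesis
    by blast
qed

text \<open>Points of the triangle have \<open>a + b\<close> at most \<open>L + 2\<close>. The bound
  \<open>L + 3\<close> also admits their neighbours outside, so the induction hypothesis applies to
  all three steps.\<close>

lemma num_forward_paths_eq_double_sum:
  assumes "L > 0" and "a + b \<le> L + 3"
  shows "int (num_forward_paths L n (point L (int a - 1) (int b - 1))) =
    double_sum (extended_meanders L n) a b"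
  using assms(2)
proof (induction n arbitrary: a b)
  case (0 a b)
  then show ?case
    using interior_or_zero[OF 0, of 0]
    by (auto simp: double_sum_initial num_forward_paths_0 point_in_triangle_iff)
next
  case (Suc n a b)
  from interior_or_zero[OF Suc.prems, of "Suc n"] show ?case
  proof
    assume "\<exists>x y. a = Suc x \<and> b = Suc y \<and> x + y \<le> L"
    then obtain x y where ab: "a = Suc x" "b = Suc y" "x + y \<le> L"
      by blast
    have "double_sum (extended_meanders L (Suc n)) a b =
        double_sum (extended_meanders L n) (Suc (Suc x)) (Suc y)
        + double_sum (extended_meanders L n) x (Suc (Suc y))
        + double_sum (extended_meanders L n) (Suc x) y"
      unfolding ab(1,2) using ab(3) assms(1)
      by (intro double_sum_recursion extended_meanders_Suc) auto
    also have "\<dots> = int (num_forward_paths L n (point L (int x + 1) (int y)))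
        + int (num_forward_paths L n (point L (int x - 1) (int y + 1)))
        + int (num_forward_paths L n (point L (int x) (int y - 1)))"
      using ab(3) Suc.IH[of "Suc (Suc x)" "Suc y"] Suc.IH[of x "Suc (Suc y)"]
        Suc.IH[of "Suc x" y] by (simp add: add.commute)
    finally show ?thesis
      using ab by (simp add: num_forward_paths_Suc point_in_triangle_iff point_add_step)
  qed simp
qed

theorem proposition17:
  fixes n L l :: nat
  assumes "L > 0" and "l \<le> L div 2"
  shows "num_forward_paths L n (origin L + real l *\<^sub>R s\<^sub>1) = (\<Sum>i = 0..l. num_motzkin_meanders L n i)"
proof -
  \<comment> \<open>The starting point lies on the side \<open>b = 1\<close>, so its rectangle is a
    single row of \<open>l + 1\<close> terms.\<close>
  have "origin L + real l *\<^sub>R s\<^sub>1 = point L (int (Suc l) - 1) (int 1 - 1)"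
    by (simp add: vec_eq_iff forall_3 origin_def s\<^sub>1_def)
  then have "int (num_forward_paths L n (origin L + real l *\<^sub>R s\<^sub>1)) =
      double_sum (extended_meanders L n) (Suc l) 1"
    using assms num_forward_paths_eq_double_sum[of L "Suc l" 1 n] by simp
  also have "\<dots> = (\<Sum>i<Suc l. extended_meanders L n i)"
    by (simp add: double_sum_def)
  also have "\<dots> = (\<Sum>i<Suc l. int (num_motzkin_meanders L n i))"
    using assms(2) by (intro sum.cong refl extended_meanders_low) auto
  also have "\<dots> = int (\<Sum>i = 0..l. num_motzkin_meanders L n i)"
    by (simp add: atLeast0AtMost lessThan_Suc_atMost)
  finally show ?thesis
    by (simp only: of_nat_eq_iff)
qed

end
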